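(* Let $R$ be an $n$-Peirce ring. Then $R$ has a complete set of orthogonal idempotents $\{e_1,\dots,e_n\}$ and a generalized matrix representation $$R\cong \begin{bmatrix} R_1 & M_{12} & \cdots & M_{1n}\\ M_{21} & R_2 & \ddots & \vdots\\ \vdots & \ddots & \ddots & M_{n-1,n}\\ M_{n1} & \cdots & M_{n,n-1} & R_n\end{bmatrix},$$ where each $R_i=e_iRe_i$ is a $1$-Peirce ring, each $M_{ij}=e_iRe_j$ with $M_{ij}M_{ji}=0$ for all $i\ne j$, and $R_1,\dots,R_n$ are unique up to isomorphism and permutation. Moreover, if $R$ satisfies any condition which transfers from a ring to its homomorphic images, or any condition which transfers from a ring $T$ to $eTe$ for every $e=e^2\in T$, then each $R_i$ also satisfies the condition.
   Context: All rings are associative with identity; for an idempotent $e$ of $R$, $eRe$ is a ring with identity $e$. An idempotent $e\in R$ is inner Peirce trivial if $eR(1-e)Re=0$, outer Peirce trivial if $(1-e)ReR(1-e)=0$, and Peirce trivial if it is both. A ring is a $0$-Peirce ring if $1=0$; a ring $R$ is a $1$-Peirce ring if $1\ne0$ and $0,1$ are its only Peirce trivial idempotents; inductively, for $n>1$, $R$ is an $n$-Peirce ring if there are a Peirce trivial idempotent $e\in R$ and an integer $1\le m<n$ such that $eRe$ is an $m$-Peirce ring and $(1-e)R(1-e)$ is an $(n-m)$-Peirce ring. A complete set of orthogonal idempotents is a finite set of pairwise orthogonal idempotents with sum $1$. *)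

theory Defs
  imports "HOL-Algebra.QuotRing"
begin

definition ring_idempotent :: "('a, 'm) ring_scheme \<Rightarrow> 'a \<Rightarrow> bool"
  where "ring_idempotent R e \<longleftrightarrow> e \<in> carrier R \<and> e \<otimes>\<^bsub>R\<^esub> e = e"

definition peirce_component :: "('a, 'm) ring_scheme \<Rightarrow> 'a \<Rightarrow> 'a \<Rightarrow> 'a set"
  where "peirce_component R e f = {e \<otimes>\<^bsub>R\<^esub> x \<otimes>\<^bsub>R\<^esub> f | x. x \<in> carrier R}"

definition corner_ring :: "('a, 'm) ring_scheme \<Rightarrow> 'a \<Rightarrow> ('a, 'm) ring_scheme"
  where "corner_ring R e = R\<lparr>carrier := peirce_component R e e, one := e\<rparr>"

text \<open>A product such as eR(1-e)Re of additive subgroups is the set of finite sums of the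
  elementwise products, so it vanishes iff every elementwise product does; this is how
  vanishing products are written below.\<close>

definition inner_peirce_trivial :: "('a, 'm) ring_scheme \<Rightarrow> 'a \<Rightarrow> bool"
  where "inner_peirce_trivial R e \<longleftrightarrow> ring_idempotent R e \<and>
    (\<forall>x \<in> carrier R. \<forall>y \<in> carrier R.
      e \<otimes>\<^bsub>R\<^esub> x \<otimes>\<^bsub>R\<^esub> (\<one>\<^bsub>R\<^esub> \<ominus>\<^bsub>R\<^esub> e) \<otimes>\<^bsub>R\<^esub> y \<otimes>\<^bsub>R\<^esub> e = \<zero>\<^bsub>R\<^esub>)"

definition outer_peirce_trivial :: "('a, 'm) ring_scheme \<Rightarrow> 'a \<Rightarrow> bool"
  where "outer_peirce_trivial R e \<longleftrightarrow> ring_idempotent R e \<and>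
    (\<forall>x \<in> carrier R. \<forall>y \<in> carrier R.
      (\<one>\<^bsub>R\<^esub> \<ominus>\<^bsub>R\<^esub> e) \<otimes>\<^bsub>R\<^esub> x \<otimes>\<^bsub>R\<^esub> e \<otimes>\<^bsub>R\<^esub> y \<otimes>\<^bsub>R\<^esub> (\<one>\<^bsub>R\<^esub> \<ominus>\<^bsub>R\<^esub> e) = \<zero>\<^bsub>R\<^esub>)"

definition peirce_trivial :: "('a, 'm) ring_scheme \<Rightarrow> 'a \<Rightarrow> bool"
  where "peirce_trivial R e \<longleftrightarrow> inner_peirce_trivial R e \<and> outer_peirce_trivial R e"

inductive peirce_ring :: "nat \<Rightarrow> ('a, 'm) ring_scheme \<Rightarrow> bool"
  where
    peirce_ring_0: "ring R \<Longrightarrow> \<one>\<^bsub>R\<^esub> = \<zero>\<^bsub>R\<^esub> \<Longrightarrow> peirce_ring 0 R"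
  | peirce_ring_1: "ring R \<Longrightarrow> \<one>\<^bsub>R\<^esub> \<noteq> \<zero>\<^bsub>R\<^esub> \<Longrightarrow>
      {e. peirce_trivial R e} = {\<zero>\<^bsub>R\<^esub>, \<one>\<^bsub>R\<^esub>} \<Longrightarrow> peirce_ring 1 R"
  | peirce_ring_step: "ring R \<Longrightarrow> n > 1 \<Longrightarrow> peirce_trivial R e \<Longrightarrow> 1 \<le> m \<Longrightarrow> m < n \<Longrightarrow>
      peirce_ring m (corner_ring R e) \<Longrightarrow>
      peirce_ring (n - m) (corner_ring R (\<one>\<^bsub>R\<^esub> \<ominus>\<^bsub>R\<^esub> e)) \<Longrightarrow> peirce_ring n R"

definition complete_orthogonal_idempotents ::
  "('a, 'm) ring_scheme \<Rightarrow> nat \<Rightarrow> (nat \<Rightarrow> 'a) \<Rightarrow> bool"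
  where "complete_orthogonal_idempotents R n e \<longleftrightarrow>
    (\<forall>i \<in> {1..n}. ring_idempotent R (e i)) \<and>
    (\<forall>i \<in> {1..n}. \<forall>j \<in> {1..n}. i \<noteq> j \<longrightarrow> e i \<otimes>\<^bsub>R\<^esub> e j = \<zero>\<^bsub>R\<^esub>) \<and>
    (\<Oplus>\<^bsub>R\<^esub>i \<in> {1..n}. e i) = \<one>\<^bsub>R\<^esub>"

text \<open>The generalized matrix ring with (i,j) entries in e i R e j (so the diagonal entries
  come from the corner rings), whose products of entries are the multiplication of R.\<close>

definition generalized_matrix_ring ::
  "('a, 'm) ring_scheme \<Rightarrow> nat \<Rightarrow> (nat \<Rightarrow> 'a) \<Rightarrow> (nat \<times> nat \<Rightarrow> 'a) ring"
  where "generalized_matrix_ring R n e =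
    \<lparr>carrier = (\<Pi>\<^sub>E (i, j) \<in> {1..n} \<times> {1..n}. peirce_component R (e i) (e j)),
     mult = (\<lambda>A B. \<lambda>(i, j) \<in> {1..n} \<times> {1..n}. \<Oplus>\<^bsub>R\<^esub>k \<in> {1..n}. A (i, k) \<otimes>\<^bsub>R\<^esub> B (k, j)),
     one = (\<lambda>(i, j) \<in> {1..n} \<times> {1..n}. if i = j then e i else \<zero>\<^bsub>R\<^esub>),
     zero = (\<lambda>(i, j) \<in> {1..n} \<times> {1..n}. \<zero>\<^bsub>R\<^esub>),
     add = (\<lambda>A B. \<lambda>(i, j) \<in> {1..n} \<times> {1..n}. A (i, j) \<oplus>\<^bsub>R\<^esub> B (i, j))\<rparr>"

definition peirce_representation ::
  "('a, 'm) ring_scheme \<Rightarrow> nat \<Rightarrow> (nat \<Rightarrow> 'a) \<Rightarrow> bool"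
  where "peirce_representation R n e \<longleftrightarrow>
    complete_orthogonal_idempotents R n e \<and>
    ring (generalized_matrix_ring R n e) \<and>
    R \<simeq> generalized_matrix_ring R n e \<and>
    (\<forall>i \<in> {1..n}. peirce_ring 1 (corner_ring R (e i))) \<and>
    (\<forall>i \<in> {1..n}. \<forall>j \<in> {1..n}. i \<noteq> j \<longrightarrow>
      (\<forall>x \<in> peirce_component R (e i) (e j). \<forall>y \<in> peirce_component R (e j) (e i).
        x \<otimes>\<^bsub>R\<^esub> y = \<zero>\<^bsub>R\<^esub>))"

definition transfers_to_hom_images :: "(('a, 'm) ring_scheme \<Rightarrow> bool) \<Rightarrow> bool"
  where "transfers_to_hom_images P \<longleftrightarrow>
    (\<forall>S T h. ring S \<and> ring T \<and> h \<in> ring_hom S T \<and> h ` carrier S = carrier T \<and> P S \<longrightarrow> P T)"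

definition transfers_to_corners :: "(('a, 'm) ring_scheme \<Rightarrow> bool) \<Rightarrow> bool"
  where "transfers_to_corners P \<longleftrightarrow>
    (\<forall>T e. ring T \<and> ring_idempotent T e \<and> P T \<longrightarrow> P (corner_ring T e))"

end

theory Submission
  imports Defs
begin

text \<open>Let \<open>e\<^sub>1, \<dots>, e\<^sub>n\<close> be complete orthogonal idempotents with \<open>e\<^sub>i R e\<^sub>j R e\<^sub>i = 0\<close> for
  \<open>i \<noteq> j\<close>. The main tool is that then the compression \<open>x \<mapsto> e\<^sub>i x e\<^sub>i\<close> is a surjective
  ring homomorphism from \<open>R\<close> onto the corner \<open>e\<^sub>i R e\<^sub>i\<close> (\<open>compression_hom\<close>), because in
  \<open>e\<^sub>i x y e\<^sub>i = \<Sum>\<^sub>k e\<^sub>i x e\<^sub>k y e\<^sub>i\<close> only the term with \<open>k = i\<close> survives. So \<open>e\<^sub>i R e\<^sub>i\<close> is both a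
  corner and a homomorphic image of \<open>R\<close>, which gives the transfer of ring conditions at once.

  For existence, unfold the recursion that makes \<open>R\<close> an \<open>n\<close>-Peirce ring. Idempotents obtained in
  \<open>eRe\<close> and in \<open>(1-e)R(1-e)\<close> are put side by side (\<open>complete_orthogonal_glue\<close>); a round trip
  between the two groups passes through \<open>eR(1-e)Re\<close> or \<open>(1-e)ReR(1-e)\<close>, both of which vanish when
  \<open>e\<close> is Peirce trivial (\<open>peirce_orthogonal_glue\<close>). The matrix representation needs only
  completeness and orthogonality (\<open>matrix_iso\<close>).

  Uniqueness is more delicate, since a ring may have representations of different lengths. Let \<open>S\<close>
  be the path algebra, over a field \<open>k\<close>, of the oriented cycle on three vertices, modulo the paths of
  length three. It is a 1-Peirce ring, hence represented by the single idempotent 1; but its three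
  vertex idempotents also form a representation, with all corners equal to \<open>k\<close>. Two arbitrary
  representations are therefore not compared directly, but each with the idempotents \<open>d\<^sub>1, \<dots>, d\<^sub>n\<close>
  coming from the recursion. These have an additional property (\<open>peirce_ring_decomposition\<close>): a
  surjective homomorphism to a 1-Peirce ring sends some \<open>d\<^sub>i\<close> to 1, because it sends a Peirce trivial
  idempotent to a Peirce trivial one, that is to 0 or to 1, at every step of the recursion. Apply
  this to the compressions to the corners \<open>f\<^sub>j R f\<^sub>j\<close> of a second representation: each \<open>j\<close> has
  exactly one index \<open>\<tau> j\<close> for which \<open>d\<^sub>i\<close> with \<open>i = \<tau> j\<close> compresses to \<open>f\<^sub>j\<close>, and all other
  \<open>d\<^sub>i\<close> compress to 0. The map \<open>\<tau>\<close> is onto, since \<open>d\<^sub>i = \<Sum>\<^sub>j d\<^sub>i f\<^sub>j d\<^sub>i\<close> is nonzero; as both families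
  have \<open>n\<close> members, \<open>\<tau>\<close> is a permutation. Then also \<open>d\<^sub>i f\<^sub>j d\<^sub>i = d\<^sub>i\<close> for \<open>i = \<tau> j\<close>, and the two
  compressions restrict to mutually inverse isomorphisms of \<open>d\<^sub>i R d\<^sub>i\<close> and \<open>f\<^sub>j R f\<^sub>j\<close>
  (\<open>corner_rings_iso_up_to_permutation\<close>).\<close>

section \<open>Corner rings\<close>

lemma corner_ring_simps [simp]:
  "carrier (corner_ring R e) = peirce_component R e e"
  "mult (corner_ring R e) = mult R"
  "one (corner_ring R e) = e"
  "zero (corner_ring R e) = zero R"
  "add (corner_ring R e) = add R"
  by (simp_all add: corner_ring_def)

lemma ring_idempotentD:
  assumes "ring_idempotent R e"
  shows "e \<in> carrier R" "e \<otimes>\<^bsub>R\<^esub> e = e"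
  using assms by (simp_all add: ring_idempotent_def)

context ring
begin

lemma mem_peirce_component_iff:
  assumes "ring_idempotent R e" "ring_idempotent R f"
  shows "x \<in> peirce_component R e f \<longleftrightarrow> x \<in> carrier R \<and> e \<otimes> x = x \<and> x \<otimes> f = x"
proof
  note [simp] = ring_idempotentD(1)[OF assms(1)] ring_idempotentD(1)[OF assms(2)]
  assume "x \<in> peirce_component R e f"
  then obtain y where [simp]: "y \<in> carrier R" and x: "x = e \<otimes> y \<otimes> f"
    by (auto simp: peirce_component_def)
  have "e \<otimes> x = (e \<otimes> e) \<otimes> y \<otimes> f" "x \<otimes> f = e \<otimes> y \<otimes> (f \<otimes> f)"
    unfolding x by (simp_all add: m_assoc)
  then show "x \<in> carrier R \<and> e \<otimes> x = x \<and> x \<otimes> f = x"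
    using ring_idempotentD(2)[OF assms(1)] ring_idempotentD(2)[OF assms(2)] by (simp add: x)
next
  assume "x \<in> carrier R \<and> e \<otimes> x = x \<and> x \<otimes> f = x"
  then have "x \<in> carrier R" "x = e \<otimes> x \<otimes> f" by simp_all
  then show "x \<in> peirce_component R e f"
    unfolding peirce_component_def by blast
qed

lemma ring_corner_ring:
  assumes e: "ring_idempotent R e"
  shows "ring (corner_ring R e)"
proof -
  note [simp] = ring_idempotentD[OF e] mem_peirce_component_iff[OF e e]
  have neg: "\<exists>y \<in> peirce_component R e e. y \<oplus> x = \<zero>" if "x \<in> peirce_component R e e" for x
    using that by (intro bexI[of _ "\<ominus> x"]) (simp_all add: l_minus r_minus l_neg)
  show ?thesis
  proof (rule ringI)
    show "abelian_group (corner_ring R e)"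
      by (rule abelian_groupI) (use neg in \<open>auto simp: a_ac l_distr r_distr\<close>)
    show "monoid (corner_ring R e)"
      by (rule monoidI) (auto simp: m_assoc simp flip: m_assoc[of e])
  qed (auto simp: l_distr r_distr)
qed

text \<open>This is what makes the recursion work: the entries formed inside the corner ring \<open>eRe\<close> are
  already entries of \<open>R\<close>, since \<open>a (e x e) b = a x b\<close>.\<close>

lemma peirce_component_corner_ring:
  assumes e: "ring_idempotent R e"
    and a: "a \<in> peirce_component R e e" and b: "b \<in> peirce_component R e e"
  shows "peirce_component (corner_ring R e) a b = peirce_component R a b"
proof -
  have [simp]: "e \<in> carrier R" "a \<in> carrier R" "b \<in> carrier R"
    and ae: "a \<otimes> e = a" and eb: "e \<otimes> b = b"
    using e a b by (simp_all add: mem_peirce_component_iff ring_idempotent_def)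
  have eq: "a \<otimes> (e \<otimes> x \<otimes> e) \<otimes> b = a \<otimes> x \<otimes> b" if "x \<in> carrier R" for x
  proof -
    have "a \<otimes> (e \<otimes> x \<otimes> e) \<otimes> b = (a \<otimes> e) \<otimes> x \<otimes> (e \<otimes> b)"
      using that by (simp add: m_assoc)
    then show ?thesis by (simp add: ae eb)
  qed
  have sub: "peirce_component R e e \<subseteq> carrier R"
    by (auto simp: peirce_component_def)
  have in_corner: "e \<otimes> x \<otimes> e \<in> peirce_component R e e" if "x \<in> carrier R" for x
    using that by (auto simp: peirce_component_def)
  show ?thesis
  proof
    show "peirce_component (corner_ring R e) a b \<subseteq> peirce_component R a b"
      using sub by (auto simp: peirce_component_def[of "corner_ring R e"] peirce_component_def[of R a b])
    show "peirce_component R a b \<subseteq> peirce_component (corner_ring R e) a b"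
    proof
      fix z assume "z \<in> peirce_component R a b"
      then obtain x where x: "x \<in> carrier R" "z = a \<otimes> (e \<otimes> x \<otimes> e) \<otimes> b"
        using eq by (auto simp: peirce_component_def[of R a b])
      then show "z \<in> peirce_component (corner_ring R e) a b"
        using in_corner by (auto simp: peirce_component_def[of "corner_ring R e"])
    qed
  qed
qed

lemma corner_ring_corner_ring:
  assumes "ring_idempotent R e" "a \<in> peirce_component R e e"
  shows "corner_ring (corner_ring R e) a = corner_ring R a"
  using peirce_component_corner_ring[OF assms assms(2)]
  by (simp add: corner_ring_def[of "corner_ring R e"]) (simp add: corner_ring_def)

lemma ring_idempotent_corner_ring:
  assumes "ring_idempotent R e" "ring_idempotent (corner_ring R e) a"
  shows "ring_idempotent R a" "a \<in> peirce_component R e e"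
  using assms by (auto simp: ring_idempotent_def mem_peirce_component_iff)

lemma corner_ring_one: "corner_ring R \<one> = R"
proof -
  have "ring_idempotent R \<one>" by (simp add: ring_idempotent_def)
  then have "peirce_component R \<one> \<one> = carrier R"
    by (auto simp: mem_peirce_component_iff)
  then show ?thesis by (simp add: corner_ring_def)
qed

text \<open>A corner has another unit than \<open>R\<close> and so is not a subring, but zero and addition
  are inherited; this is what sums of idempotents need when they move from a corner to \<open>R\<close>.\<close>

lemma finsum_corner_ring:
  assumes e: "ring_idempotent R e" and "finite A" "\<And>i. i \<in> A \<Longrightarrow> g i \<in> peirce_component R e e"
  shows "finsum (corner_ring R e) g A = finsum R g A"
  using assms(2,3)
proof (induction A rule: finite_induct)
  interpret E: ring "corner_ring R e" using ring_corner_ring[OF e] .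
  {
    case empty
    show ?case by simp
  next
    case (insert i A)
    have "g \<in> A \<rightarrow> carrier R" "g i \<in> carrier R"
      using insert.prems by (auto simp: mem_peirce_component_iff[OF e e])
    moreover have "g \<in> A \<rightarrow> carrier (corner_ring R e)" "g i \<in> carrier (corner_ring R e)"
      using insert.prems by auto
    ultimately show ?case
      using insert by (simp add: E.finsum_insert)
  }
qed

lemma idempotent_complement:
  assumes "ring_idempotent R e"
  shows "ring_idempotent R (\<one> \<ominus> e)" "e \<otimes> (\<one> \<ominus> e) = \<zero>" "(\<one> \<ominus> e) \<otimes> e = \<zero>"
proof -
  note [simp] = ring_idempotentD[OF assms]
  show z: "e \<otimes> (\<one> \<ominus> e) = \<zero>" "(\<one> \<ominus> e) \<otimes> e = \<zero>"
    by (simp_all add: a_minus_def r_distr l_distr r_minus l_minus r_neg)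
  have "(\<one> \<ominus> e) \<otimes> (\<one> \<ominus> e) = (\<one> \<ominus> e) \<ominus> e \<otimes> (\<one> \<ominus> e)"
    by (simp add: a_minus_def l_distr l_minus)
  then show "ring_idempotent R (\<one> \<ominus> e)"
    by (simp add: ring_idempotent_def z) (simp add: a_minus_def)
qed

end

section \<open>Complete orthogonal sets of idempotents\<close>

context ring
begin

lemma finsum_single:
  assumes "finite A" "i \<in> A" "g \<in> A \<rightarrow> carrier R" "\<And>j. j \<in> A \<Longrightarrow> j \<noteq> i \<Longrightarrow> g j = \<zero>"
  shows "finsum R g A = g i"
proof -
  have "finsum R g A = (\<Oplus>j \<in> A. if i = j then g j else \<zero>)"
    by (rule finsum_cong') (use assms in auto)
  also have "\<dots> = g i"
    using assms by (intro add.finprod_singleton) auto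
  finally show ?thesis .
qed

lemma complete_orthogonalD:
  assumes "complete_orthogonal_idempotents R n e"
  shows "i \<in> {1..n} \<Longrightarrow> ring_idempotent R (e i)"
    "i \<in> {1..n} \<Longrightarrow> e i \<in> carrier R"
    "i \<in> {1..n} \<Longrightarrow> e i \<otimes> e i = e i"
    "i \<in> {1..n} \<Longrightarrow> j \<in> {1..n} \<Longrightarrow> i \<noteq> j \<Longrightarrow> e i \<otimes> e j = \<zero>"
    "(\<Oplus>i \<in> {1..n}. e i) = \<one>"
  using assms by (auto simp: complete_orthogonal_idempotents_def ring_idempotent_def)

text \<open>Inserting \<open>1 = \<Sum>\<^sub>k e\<^sub>k\<close> between two factors, here with the sum already pulled out.
  With a factor \<open>\<one>\<close> it expands a single element.\<close>

lemma resolve_product: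
  assumes e: "complete_orthogonal_idempotents R n e" and [simp]: "x \<in> carrier R" "y \<in> carrier R"
  shows "x \<otimes> y = (\<Oplus>k \<in> {1..n}. x \<otimes> e k \<otimes> y)"
proof -
  note E = complete_orthogonalD[OF e]
  have "x \<otimes> y = x \<otimes> (\<Oplus>k \<in> {1..n}. e k) \<otimes> y"
    by (simp only: E(5)) simp
  also have "\<dots> = (\<Oplus>k \<in> {1..n}. x \<otimes> e k) \<otimes> y"
    using E(2) by (subst finsum_rdistr) auto
  also have "\<dots> = (\<Oplus>k \<in> {1..n}. x \<otimes> e k \<otimes> y)"
    using E(2) by (subst finsum_ldistr) auto
  finally show ?thesis .
qed

text \<open>Injectivity of the Peirce decomposition: summing the entries over columns recovers the rows
  \<open>e\<^sub>i x\<close>, and summing these recovers \<open>x\<close>.\<close>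

lemma eq_if_entries_eq:
  assumes e: "complete_orthogonal_idempotents R n e" and [simp]: "x \<in> carrier R" "y \<in> carrier R"
    and eq: "\<And>i j. i \<in> {1..n} \<Longrightarrow> j \<in> {1..n} \<Longrightarrow> e i \<otimes> x \<otimes> e j = e i \<otimes> y \<otimes> e j"
  shows "x = y"
proof -
  note E = complete_orthogonalD[OF e]
  have row: "e i \<otimes> x = e i \<otimes> y" if i: "i \<in> {1..n}" for i
  proof -
    have "e i \<otimes> z = (\<Oplus>k \<in> {1..n}. e i \<otimes> z \<otimes> e k)" if "z \<in> carrier R" for z
      using resolve_product[OF e, of "e i \<otimes> z" \<one>] that E(2) i by (simp cong: finsum_cong)
    then have "e i \<otimes> x = (\<Oplus>k \<in> {1..n}. e i \<otimes> x \<otimes> e k)" "e i \<otimes> y = (\<Oplus>k \<in> {1..n}. e i \<otimes> y \<otimes> e k)"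
      by simp_all
    moreover have "(\<Oplus>k \<in> {1..n}. e i \<otimes> x \<otimes> e k) = (\<Oplus>k \<in> {1..n}. e i \<otimes> y \<otimes> e k)"
      using eq[OF i] E(2) i by (intro finsum_cong') auto
    ultimately show ?thesis by simp
  qed
  have "z = (\<Oplus>k \<in> {1..n}. e k \<otimes> z)" if "z \<in> carrier R" for z
    using resolve_product[OF e, of \<one> z] that E(2) by (simp cong: finsum_cong)
  then have "x = (\<Oplus>k \<in> {1..n}. e k \<otimes> x)" "y = (\<Oplus>k \<in> {1..n}. e k \<otimes> y)"
    by simp_all
  moreover have "(\<Oplus>k \<in> {1..n}. e k \<otimes> x) = (\<Oplus>k \<in> {1..n}. e k \<otimes> y)"
    using row E(2) by (intro finsum_cong') auto
  ultimately show ?thesis by simp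
qed

lemma matrix_iso:
  assumes e: "complete_orthogonal_idempotents R n e"
  shows "(\<lambda>x. \<lambda>(i, j) \<in> {1..n} \<times> {1..n}. e i \<otimes> x \<otimes> e j) \<in> ring_iso R (generalized_matrix_ring R n e)"
    (is "?h \<in> _")
proof -
  let ?I = "{1..n} \<times> {1..n}"
  note E = complete_orthogonalD[OF e]
  note comp = mem_peirce_component_iff[OF E(1) E(1)]
  show ?thesis
  proof (rule ring_iso_memI)
    show closed: "?h x \<in> carrier (generalized_matrix_ring R n e)" if "x \<in> carrier R" for x
      using that by (auto simp: generalized_matrix_ring_def peirce_component_def)
    show "?h (x \<otimes> y) = ?h x \<otimes>\<^bsub>generalized_matrix_ring R n e\<^esub> ?h y"
      if [simp]: "x \<in> carrier R" "y \<in> carrier R" for x y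
    proof -
      have "e i \<otimes> (x \<otimes> y) \<otimes> e j = (\<Oplus>k \<in> {1..n}. (e i \<otimes> x \<otimes> e k) \<otimes> (e k \<otimes> y \<otimes> e j))"
        if ij: "i \<in> {1..n}" "j \<in> {1..n}" for i j
      proof -
        have [simp]: "e i \<in> carrier R" "e j \<in> carrier R" using E(2) ij by auto
        have "e i \<otimes> (x \<otimes> y) \<otimes> e j = (e i \<otimes> x) \<otimes> (y \<otimes> e j)"
          by (simp add: m_assoc)
        also have "\<dots> = (\<Oplus>k \<in> {1..n}. e i \<otimes> x \<otimes> e k \<otimes> (y \<otimes> e j))"
          by (rule resolve_product[OF e]) simp_all
        also have "\<dots> = (\<Oplus>k \<in> {1..n}. (e i \<otimes> x \<otimes> e k) \<otimes> (e k \<otimes> y \<otimes> e j))"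
        proof (rule finsum_cong')
          fix k assume k: "k \<in> {1..n}"
          then have [simp]: "e k \<in> carrier R" using E(2) by auto
          have "(e i \<otimes> x \<otimes> e k) \<otimes> (e k \<otimes> y \<otimes> e j) = e i \<otimes> x \<otimes> (e k \<otimes> e k) \<otimes> (y \<otimes> e j)"
            by (simp add: m_assoc)
          then show "e i \<otimes> x \<otimes> e k \<otimes> (y \<otimes> e j) = (e i \<otimes> x \<otimes> e k) \<otimes> (e k \<otimes> y \<otimes> e j)"
            using E(3)[OF k] by simp
        qed (use E(2) in auto)
        finally show ?thesis .
      qed
      then show ?thesis
        unfolding generalized_matrix_ring_def
        by (auto simp: fun_eq_iff restrict_def intro!: finsum_cong' m_closed E(2))
    qed
    show "?h (x \<oplus> y) = ?h x \<oplus>\<^bsub>generalized_matrix_ring R n e\<^esub> ?h y"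
      if "x \<in> carrier R" "y \<in> carrier R" for x y
      using that E(2) by (auto simp: generalized_matrix_ring_def fun_eq_iff restrict_def r_distr l_distr)
    show "?h \<one> = \<one>\<^bsub>generalized_matrix_ring R n e\<^esub>"
      using E(2-4) by (auto simp: generalized_matrix_ring_def fun_eq_iff restrict_def)
    have inj: "inj_on ?h (carrier R)"
    proof (rule inj_onI)
      fix x y assume xy: "x \<in> carrier R" "y \<in> carrier R" and eq: "?h x = ?h y"
      show "x = y"
      proof (rule eq_if_entries_eq[OF e xy])
        fix i j assume "i \<in> {1..n}" "j \<in> {1..n}"
        then show "e i \<otimes> x \<otimes> e j = e i \<otimes> y \<otimes> e j"
          using fun_cong[OF eq, of "(i, j)"] by simp
      qed
    qed
    have surj: "\<exists>x \<in> carrier R. ?h x = A" if A: "A \<in> carrier (generalized_matrix_ring R n e)" for A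
    proof -
      have "A (i, j) \<in> peirce_component R (e i) (e j)" if "i \<in> {1..n}" "j \<in> {1..n}" for i j
        using A that PiE_mem[of A ?I _ "(i, j)"] by (auto simp: generalized_matrix_ring_def)
      then have Ac [simp]: "A (i, j) \<in> carrier R"
        and Al: "e i \<otimes> A (i, j) = A (i, j)" and Ar: "A (i, j) \<otimes> e j = A (i, j)"
        if "i \<in> {1..n}" "j \<in> {1..n}" for i j
        using that comp by blast+
      \<comment> \<open>The sum of all entries of \<open>A\<close>, taken in \<open>R\<close>: multiplying by \<open>e i\<close> and \<open>e j\<close> kills every
        entry except the one at \<open>(i, j)\<close>.\<close>
      define x where "x = (\<Oplus>p \<in> ?I. A p)"
      have Acp: "A \<in> ?I \<rightarrow> carrier R" using Ac by auto
      have x: "x \<in> carrier R" unfolding x_def using Acp by (rule finsum_closed)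
      have entry: "e i \<otimes> x \<otimes> e j = A (i, j)" if ij: "i \<in> {1..n}" "j \<in> {1..n}" for i j
      proof -
        have [simp]: "e i \<in> carrier R" "e j \<in> carrier R" using E(2) ij by auto
        have "e i \<otimes> x \<otimes> e j = (\<Oplus>p \<in> ?I. e i \<otimes> A p) \<otimes> e j"
          unfolding x_def using Acp by (subst finsum_rdistr) auto
        also have "\<dots> = (\<Oplus>p \<in> ?I. e i \<otimes> A p \<otimes> e j)"
          using Acp by (subst finsum_ldistr) auto
        also have "\<dots> = e i \<otimes> A (i, j) \<otimes> e j"
        proof (rule finsum_single)
          fix p assume p: "p \<in> ?I" "p \<noteq> (i, j)"
          then obtain k l where kl: "p = (k, l)" "k \<in> {1..n}" "l \<in> {1..n}" by auto
          then have [simp]: "e k \<in> carrier R" "e l \<in> carrier R" "A (k, l) \<in> carrier R"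
            using E(2) by auto
          have "e i \<otimes> A p \<otimes> e j = e i \<otimes> (e k \<otimes> A (k, l) \<otimes> e l) \<otimes> e j"
            using kl by (simp add: Al Ar)
          also have "\<dots> = (e i \<otimes> e k) \<otimes> A (k, l) \<otimes> (e l \<otimes> e j)"
            by (simp add: m_assoc)
          also have "\<dots> = \<zero>"
            using p kl ij E(4)[of i k] E(4)[of l j] by (cases "i = k") auto
          finally show "e i \<otimes> A p \<otimes> e j = \<zero>" .
        qed (use ij Acp in auto)
        finally show ?thesis using ij by (simp add: Al Ar)
      qed
      have "?h x = A"
      proof
        fix p
        show "?h x p = A p"
          using entry A PiE_arb[of A ?I _ p] by (cases "p \<in> ?I") (auto simp: generalized_matrix_ring_def)
      qed
      with x show ?thesis by blast
    qed
    have "?h ` carrier R = carrier (generalized_matrix_ring R n e)"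
    proof
      show "?h ` carrier R \<subseteq> carrier (generalized_matrix_ring R n e)"
        using closed by (intro image_subsetI)
      show "carrier (generalized_matrix_ring R n e) \<subseteq> ?h ` carrier R"
      proof
        fix A assume "A \<in> carrier (generalized_matrix_ring R n e)"
        then obtain x where x: "x \<in> carrier R" "?h x = A" using surj by blast
        show "A \<in> ?h ` carrier R" using imageI[OF x(1), of ?h] by (simp only: x(2))
      qed
    qed
    with inj show "bij_betw ?h (carrier R) (carrier (generalized_matrix_ring R n e))"
      by (rule bij_betw_imageI)
  qed
qed

text \<open>The ring laws need not be checked on matrices: they are transported along the bijection, which
  respects all operations.\<close>

lemma ring_generalized_matrix_ring:
  assumes e: "complete_orthogonal_idempotents R n e"
  shows "ring (generalized_matrix_ring R n e)"
proof -
  let ?G = "generalized_matrix_ring R n e"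
  let ?h = "\<lambda>x. \<lambda>(i, j) \<in> {1..n} \<times> {1..n}. e i \<otimes> x \<otimes> e j"
  have "?h \<zero> = \<zero>\<^bsub>?G\<^esub>"
    using complete_orthogonalD(2)[OF e]
    by (auto simp: generalized_matrix_ring_def fun_eq_iff restrict_def)
  then have "?G\<lparr>zero := ?h \<zero>\<rparr> = ?G" by (simp add: generalized_matrix_ring_def)
  then show ?thesis
    using ring_iso_imp_img_ring[OF matrix_iso[OF e]] by simp
qed

end

section \<open>Compression to a corner\<close>

text \<open>The condition \<open>M\<^sub>i\<^sub>j M\<^sub>j\<^sub>i = 0\<close> on a family of idempotents.\<close>

definition peirce_orthogonal :: "('a, 'm) ring_scheme \<Rightarrow> nat \<Rightarrow> (nat \<Rightarrow> 'a) \<Rightarrow> bool"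
  where "peirce_orthogonal R n e \<longleftrightarrow>
    (\<forall>i \<in> {1..n}. \<forall>j \<in> {1..n}. i \<noteq> j \<longrightarrow>
      (\<forall>x \<in> peirce_component R (e i) (e j). \<forall>y \<in> peirce_component R (e j) (e i).
        x \<otimes>\<^bsub>R\<^esub> y = \<zero>\<^bsub>R\<^esub>))"

context ring
begin

lemma round_trip_zero:
  assumes e: "complete_orthogonal_idempotents R n e" "peirce_orthogonal R n e"
    and i: "i \<in> {1..n}" and j: "j \<in> {1..n}" and "i \<noteq> j" and [simp]: "x \<in> carrier R" "y \<in> carrier R"
  shows "(e i \<otimes> x) \<otimes> e j \<otimes> (y \<otimes> e i) = \<zero>"
proof -
  have [simp]: "e i \<in> carrier R" "e j \<in> carrier R"
    using complete_orthogonalD(2)[OF e(1)] i j by auto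
  have "(e i \<otimes> x \<otimes> e j) \<otimes> (e j \<otimes> y \<otimes> e i) = (e i \<otimes> x) \<otimes> (e j \<otimes> e j) \<otimes> (y \<otimes> e i)"
    by (simp add: m_assoc)
  moreover have "(e i \<otimes> x \<otimes> e j) \<otimes> (e j \<otimes> y \<otimes> e i) = \<zero>"
    using e(2) i j \<open>i \<noteq> j\<close> \<open>x \<in> carrier R\<close> \<open>y \<in> carrier R\<close>
    unfolding peirce_orthogonal_def peirce_component_def by blast
  ultimately show ?thesis
    using complete_orthogonalD(3)[OF e(1) j] by simp
qed

text \<open>Between \<open>x\<close> and \<open>y\<close> the identity splits into the \<open>e\<^sub>k\<close>, and for \<open>k \<noteq> i\<close> the term is a round
  trip \<open>e\<^sub>i R e\<^sub>k R e\<^sub>i\<close>.\<close>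

lemma compression_mult:
  assumes e: "complete_orthogonal_idempotents R n e" "peirce_orthogonal R n e"
    and i: "i \<in> {1..n}" and [simp]: "x \<in> carrier R" "y \<in> carrier R"
  shows "e i \<otimes> (x \<otimes> y) \<otimes> e i = (e i \<otimes> x \<otimes> e i) \<otimes> (e i \<otimes> y \<otimes> e i)"
proof -
  note E = complete_orthogonalD[OF e(1)]
  have [simp]: "e i \<in> carrier R" using E(2) i by auto
  have "e i \<otimes> (x \<otimes> y) \<otimes> e i = (e i \<otimes> x) \<otimes> (y \<otimes> e i)"
    by (simp add: m_assoc)
  also have "\<dots> = (\<Oplus>k \<in> {1..n}. (e i \<otimes> x) \<otimes> e k \<otimes> (y \<otimes> e i))"
    by (rule resolve_product[OF e(1)]) simp_all
  also have "\<dots> = (e i \<otimes> x) \<otimes> e i \<otimes> (y \<otimes> e i)"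
    by (rule finsum_single) (use i E(2) round_trip_zero[OF e i] in auto)
  also have "\<dots> = (e i \<otimes> x) \<otimes> (e i \<otimes> e i) \<otimes> (y \<otimes> e i)"
    using E(3)[OF i] by simp
  also have "\<dots> = (e i \<otimes> x \<otimes> e i) \<otimes> (e i \<otimes> y \<otimes> e i)"
    by (simp add: m_assoc)
  finally show ?thesis .
qed

lemma compression_hom:
  assumes e: "complete_orthogonal_idempotents R n e" "peirce_orthogonal R n e" and i: "i \<in> {1..n}"
  shows "(\<lambda>x. e i \<otimes> x \<otimes> e i) \<in> ring_hom R (corner_ring R (e i))"
    "(\<lambda>x. e i \<otimes> x \<otimes> e i) ` carrier R = carrier (corner_ring R (e i))"
proof -
  have [simp]: "e i \<in> carrier R" and idem: "e i \<otimes> e i = e i"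
    using complete_orthogonalD(2,3)[OF e(1) i] by auto
  show "(\<lambda>x. e i \<otimes> x \<otimes> e i) \<in> ring_hom R (corner_ring R (e i))"
    by (rule ring_hom_memI)
      (auto simp: peirce_component_def compression_mult[OF e i] l_distr r_distr idem)
  show "(\<lambda>x. e i \<otimes> x \<otimes> e i) ` carrier R = carrier (corner_ring R (e i))"
    by (auto simp: peirce_component_def)
qed

lemma compression_conjugate:
  assumes e: "complete_orthogonal_idempotents R n e" "peirce_orthogonal R n e"
    and i: "i \<in> {1..n}" and [simp]: "x \<in> carrier R" "y \<in> carrier R"
  shows "e i \<otimes> (y \<otimes> x \<otimes> y) \<otimes> e i = (e i \<otimes> y \<otimes> e i) \<otimes> (e i \<otimes> x \<otimes> e i) \<otimes> (e i \<otimes> y \<otimes> e i)"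
  by (simp add: compression_mult[OF e i])

text \<open>Being killed by compression is symmetric. As compression is multiplicative, \<open>e\<^sub>i f e\<^sub>i\<close> is
  idempotent, and its square contains the factor \<open>f e\<^sub>i f\<close>.\<close>

lemma compression_zero_sym:
  assumes e: "complete_orthogonal_idempotents R n e" "peirce_orthogonal R n e" and i: "i \<in> {1..n}"
    and f: "f \<in> carrier R" "f \<otimes> f = f" and zero: "f \<otimes> e i \<otimes> f = \<zero>"
  shows "e i \<otimes> f \<otimes> e i = \<zero>"
proof -
  have [simp]: "e i \<in> carrier R" "f \<in> carrier R" and idem: "e i \<otimes> e i = e i"
    using complete_orthogonalD(2,3)[OF e(1) i] f by auto
  have *: "e i \<otimes> f \<otimes> e i = e i \<otimes> f \<otimes> e i \<otimes> (e i \<otimes> f \<otimes> e i)"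
    using compression_mult[OF e i, of f f] f by simp
  have "e i \<otimes> f \<otimes> e i \<otimes> (e i \<otimes> f \<otimes> e i) = e i \<otimes> (f \<otimes> (e i \<otimes> e i) \<otimes> f) \<otimes> e i"
    by (simp add: m_assoc)
  also have "\<dots> = \<zero>" by (simp add: idem zero)
  finally show ?thesis using * by simp
qed

text \<open>When each of the two idempotents compresses to the other, the two compressions are mutually
  inverse on the corners: \<open>e\<^sub>i (f\<^sub>j x f\<^sub>j) e\<^sub>i = (e\<^sub>i f\<^sub>j e\<^sub>i) (e\<^sub>i x e\<^sub>i) (e\<^sub>i f\<^sub>j e\<^sub>i) = x\<close> for \<open>x\<close> in
  \<open>e\<^sub>i R e\<^sub>i\<close>, and likewise with the roles exchanged.\<close>

lemma corner_rings_iso: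
  assumes e: "complete_orthogonal_idempotents R n e" "peirce_orthogonal R n e" and i: "i \<in> {1..n}"
    and f: "complete_orthogonal_idempotents R m f" "peirce_orthogonal R m f" and j: "j \<in> {1..m}"
    and efe: "e i \<otimes> f j \<otimes> e i = e i" and fef: "f j \<otimes> e i \<otimes> f j = f j"
  shows "corner_ring R (e i) \<simeq> corner_ring R (f j)"
proof -
  let ?\<phi> = "\<lambda>x. f j \<otimes> x \<otimes> f j" and ?\<psi> = "\<lambda>x. e i \<otimes> x \<otimes> e i"
  have ei: "ring_idempotent R (e i)" and fj: "ring_idempotent R (f j)"
    using complete_orthogonalD(1) e(1) f(1) i j by blast+
  note [simp] = ring_idempotentD(1)[OF ei] ring_idempotentD(1)[OF fj]
  have \<phi>\<psi>: "?\<phi> (?\<psi> x) = x" if "x \<in> peirce_component R (f j) (f j)" for x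
    using that compression_conjugate[OF f j, of x "e i"] fef
    by (simp add: mem_peirce_component_iff[OF fj fj])
  have \<psi>\<phi>: "?\<psi> (?\<phi> x) = x" if "x \<in> peirce_component R (e i) (e i)" for x
    using that compression_conjugate[OF e i, of x "f j"] efe
    by (simp add: mem_peirce_component_iff[OF ei ei])
  have carr: "x \<in> peirce_component R (e i) (e i) \<Longrightarrow> x \<in> carrier R"
    "x \<in> peirce_component R (f j) (f j) \<Longrightarrow> x \<in> carrier R" for x
    using mem_peirce_component_iff[OF ei ei] mem_peirce_component_iff[OF fj fj] by auto
  have \<phi>_in: "?\<phi> x \<in> peirce_component R (f j) (f j)" and \<psi>_in: "?\<psi> x \<in> peirce_component R (e i) (e i)"
    if "x \<in> carrier R" for x
    using that by (auto simp: peirce_component_def)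
  have "?\<phi> \<in> ring_iso (corner_ring R (e i)) (corner_ring R (f j))"
  proof (rule ring_iso_memI)
    show "bij_betw ?\<phi> (carrier (corner_ring R (e i))) (carrier (corner_ring R (f j)))"
    proof (rule bij_betwI[where g = ?\<psi>])
      show "?\<phi> \<in> carrier (corner_ring R (e i)) \<rightarrow> carrier (corner_ring R (f j))"
        using carr \<phi>_in by simp
      show "?\<psi> \<in> carrier (corner_ring R (f j)) \<rightarrow> carrier (corner_ring R (e i))"
        using carr \<psi>_in by simp
    qed (use \<phi>\<psi> \<psi>\<phi> in simp_all)
  qed (use carr fef \<phi>_in in \<open>simp_all add: compression_mult[OF f j] l_distr r_distr\<close>)
  then show ?thesis by (auto simp: is_ring_iso_def)
qed

text \<open>The hypothesis \<open>full\<close> assigns to each \<open>f\<^sub>j\<close> an \<open>e\<^sub>i\<close> that compresses to it. The assignment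
  is onto because no \<open>e\<^sub>i\<close> may be killed by all \<open>f\<^sub>j\<close>, and the equal number of idempotents on both
  sides makes it a bijection.\<close>

lemma corner_rings_iso_up_to_permutation:
  assumes e: "complete_orthogonal_idempotents R n e" "peirce_orthogonal R n e"
    and f: "complete_orthogonal_idempotents R n f" "peirce_orthogonal R n f"
    and nz: "\<And>i. i \<in> {1..n} \<Longrightarrow> e i \<noteq> \<zero>"
    and full: "\<And>j. j \<in> {1..n} \<Longrightarrow> \<exists>i \<in> {1..n}. f j \<otimes> e i \<otimes> f j = f j"
  shows "\<exists>\<sigma>. bij_betw \<sigma> {1..n} {1..n} \<and> (\<forall>i \<in> {1..n}. corner_ring R (e i) \<simeq> corner_ring R (f (\<sigma> i)))"
proof -
  note E = complete_orthogonalD[OF e(1)] and F = complete_orthogonalD[OF f(1)]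
  from full obtain \<tau> where \<tau>: "\<And>j. j \<in> {1..n} \<Longrightarrow> \<tau> j \<in> {1..n} \<and> f j \<otimes> e (\<tau> j) \<otimes> f j = f j"
    by metis
  \<comment> \<open>Compression to \<open>f j\<close> is a homomorphism, so idempotents orthogonal to \<open>e (\<tau> j)\<close>, which
    becomes the unit, become 0.\<close>
  have other: "f j \<otimes> e i \<otimes> f j = \<zero>" if ij: "i \<in> {1..n}" "j \<in> {1..n}" "\<tau> j \<noteq> i" for i j
  proof -
    have [simp]: "e i \<in> carrier R" "e (\<tau> j) \<in> carrier R" "f j \<in> carrier R"
      using E(2) F(2) \<tau> ij by auto
    have "f j \<otimes> e i \<otimes> f j = f j \<otimes> e i \<otimes> f j \<otimes> f j"
      using F(3)[OF ij(2)] by (simp add: m_assoc)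
    also have "\<dots> = f j \<otimes> e i \<otimes> f j \<otimes> (f j \<otimes> e (\<tau> j) \<otimes> f j)"
      using \<tau>[OF ij(2)] by simp
    also have "\<dots> = f j \<otimes> (e i \<otimes> e (\<tau> j)) \<otimes> f j"
      by (simp add: compression_mult[OF f ij(2)])
    also have "\<dots> = \<zero>"
      using E(4)[of i "\<tau> j"] \<tau> ij by simp
    finally show ?thesis .
  qed
  have zero: "e i \<otimes> f j \<otimes> e i = \<zero>" if ij: "i \<in> {1..n}" "j \<in> {1..n}" "\<tau> j \<noteq> i" for i j
    by (rule compression_zero_sym[OF e ij(1) F(2,3)[OF ij(2)] other[OF ij]])
  have sum: "e i = (\<Oplus>j \<in> {1..n}. e i \<otimes> f j \<otimes> e i)" if "i \<in> {1..n}" for i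
    using resolve_product[OF f(1), of "e i" "e i"] E(2,3)[OF that] by simp
  have "i \<in> \<tau> ` {1..n}" if i: "i \<in> {1..n}" for i
  proof (rule ccontr)
    assume "i \<notin> \<tau> ` {1..n}"
    then have "e i \<otimes> f j \<otimes> e i = \<zero>" if "j \<in> {1..n}" for j
      using zero[OF i that] that by blast
    then have "(\<Oplus>j \<in> {1..n}. e i \<otimes> f j \<otimes> e i) = (\<Oplus>j \<in> {1..n}. \<zero>)"
      by (intro finsum_cong') auto
    then show False using sum[OF i] nz[OF i] by simp
  qed
  then have im: "\<tau> ` {1..n} = {1..n}" using \<tau> by auto
  then have inj: "inj_on \<tau> {1..n}" by (simp add: eq_card_imp_inj_on)
  with im have bij: "bij_betw \<tau> {1..n} {1..n}" by (simp add: bij_betw_def)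
  let ?\<sigma> = "inv_into {1..n} \<tau>"
  have "corner_ring R (e i) \<simeq> corner_ring R (f (?\<sigma> i))" if i: "i \<in> {1..n}" for i
  proof -
    have j: "?\<sigma> i \<in> {1..n}" and \<tau>j: "\<tau> (?\<sigma> i) = i"
      using im i by (metis inv_into_into, metis f_inv_into_f)
    have "(\<Oplus>j \<in> {1..n}. e i \<otimes> f j \<otimes> e i) = e i \<otimes> f (?\<sigma> i) \<otimes> e i"
    proof (rule finsum_single)
      fix k assume k: "k \<in> {1..n}" "k \<noteq> ?\<sigma> i"
      then have "\<tau> k \<noteq> i" using inv_into_f_f[OF inj k(1)] by auto
      then show "e i \<otimes> f k \<otimes> e i = \<zero>" using zero[OF i k(1)] by simp
    qed (use j E(2)[OF i] F(2) in auto)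
    then have "e i \<otimes> f (?\<sigma> i) \<otimes> e i = e i" using sum[OF i] by simp
    then show ?thesis
      using corner_rings_iso[OF e i f j] \<tau>[OF j] \<tau>j by simp
  qed
  with bij_betw_inv_into[OF bij] show ?thesis by blast
qed

end

section \<open>Peirce trivial idempotents\<close>

lemma peirce_ring_oneD:
  assumes "peirce_ring 1 T"
  shows "ring T" "\<one>\<^bsub>T\<^esub> \<noteq> \<zero>\<^bsub>T\<^esub>" "peirce_trivial T g \<Longrightarrow> g = \<zero>\<^bsub>T\<^esub> \<or> g = \<one>\<^bsub>T\<^esub>"
proof -
  have "ring T \<and> \<one>\<^bsub>T\<^esub> \<noteq> \<zero>\<^bsub>T\<^esub> \<and> {e. peirce_trivial T e} = {\<zero>\<^bsub>T\<^esub>, \<one>\<^bsub>T\<^esub>}"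
    using assms
  proof (cases rule: peirce_ring.cases)
    case peirce_ring_1
    then show ?thesis by blast
  qed linarith+
  then show "ring T" "\<one>\<^bsub>T\<^esub> \<noteq> \<zero>\<^bsub>T\<^esub>" "peirce_trivial T g \<Longrightarrow> g = \<zero>\<^bsub>T\<^esub> \<or> g = \<one>\<^bsub>T\<^esub>"
    by blast+
qed

lemma peirce_ring_imp_ring: "peirce_ring n R \<Longrightarrow> ring R"
  by (cases rule: peirce_ring.cases)

text \<open>Peirce triviality consists of identities in \<open>e\<close> and two universally quantified elements;
  surjectivity lets these range over all of \<open>T\<close>.\<close>

lemma peirce_trivial_hom_image:
  assumes "ring R" "ring T" and h: "h \<in> ring_hom R T" "h ` carrier R = carrier T"
    and e: "peirce_trivial R e"
  shows "peirce_trivial T (h e)" "h (\<one>\<^bsub>R\<^esub> \<ominus>\<^bsub>R\<^esub> e) = \<one>\<^bsub>T\<^esub> \<ominus>\<^bsub>T\<^esub> h e"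
proof -
  interpret H: ring_hom_ring R T h
    using assms(1-3) by (rule ring_hom_ringI2)
  have [simp]: "e \<in> carrier R" and idem: "e \<otimes>\<^bsub>R\<^esub> e = e"
    using e by (auto simp: peirce_trivial_def inner_peirce_trivial_def ring_idempotent_def)
  show minus: "h (\<one>\<^bsub>R\<^esub> \<ominus>\<^bsub>R\<^esub> e) = \<one>\<^bsub>T\<^esub> \<ominus>\<^bsub>T\<^esub> h e"
    by (simp add: a_minus_def)
  have id: "ring_idempotent T (h e)"
    using arg_cong[OF idem, of h] by (simp add: ring_idempotent_def)
  have inner: "h e \<otimes>\<^bsub>T\<^esub> h x \<otimes>\<^bsub>T\<^esub> (\<one>\<^bsub>T\<^esub> \<ominus>\<^bsub>T\<^esub> h e) \<otimes>\<^bsub>T\<^esub> h y \<otimes>\<^bsub>T\<^esub> h e = \<zero>\<^bsub>T\<^esub>"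
    if xy: "x \<in> carrier R" "y \<in> carrier R" for x y
  proof -
    have "h (e \<otimes>\<^bsub>R\<^esub> x \<otimes>\<^bsub>R\<^esub> (\<one>\<^bsub>R\<^esub> \<ominus>\<^bsub>R\<^esub> e) \<otimes>\<^bsub>R\<^esub> y \<otimes>\<^bsub>R\<^esub> e) = h \<zero>\<^bsub>R\<^esub>"
      using e xy by (simp add: peirce_trivial_def inner_peirce_trivial_def)
    then show ?thesis using xy by (simp add: minus)
  qed
  have outer: "(\<one>\<^bsub>T\<^esub> \<ominus>\<^bsub>T\<^esub> h e) \<otimes>\<^bsub>T\<^esub> h x \<otimes>\<^bsub>T\<^esub> h e \<otimes>\<^bsub>T\<^esub> h y \<otimes>\<^bsub>T\<^esub> (\<one>\<^bsub>T\<^esub> \<ominus>\<^bsub>T\<^esub> h e) = \<zero>\<^bsub>T\<^esub>"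
    if xy: "x \<in> carrier R" "y \<in> carrier R" for x y
  proof -
    have "h ((\<one>\<^bsub>R\<^esub> \<ominus>\<^bsub>R\<^esub> e) \<otimes>\<^bsub>R\<^esub> x \<otimes>\<^bsub>R\<^esub> e \<otimes>\<^bsub>R\<^esub> y \<otimes>\<^bsub>R\<^esub> (\<one>\<^bsub>R\<^esub> \<ominus>\<^bsub>R\<^esub> e)) = h \<zero>\<^bsub>R\<^esub>"
      using e xy by (simp add: peirce_trivial_def outer_peirce_trivial_def)
    then show ?thesis using xy by (simp add: minus)
  qed
  show "peirce_trivial T (h e)"
    unfolding peirce_trivial_def inner_peirce_trivial_def outer_peirce_trivial_def h(2)[symmetric]
    using id inner outer by blast
qed

text \<open>A homomorphism with \<open>h e = 1\<close> does not distinguish \<open>x\<close> from \<open>exe\<close>, so its image is already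
  attained on the corner.\<close>

lemma hom_restrict_corner:
  assumes "ring R" "ring T" and h: "h \<in> ring_hom R T" "h ` carrier R = carrier T"
    and e: "ring_idempotent R e" and one: "h e = \<one>\<^bsub>T\<^esub>"
  shows "h \<in> ring_hom (corner_ring R e) T" "h ` carrier (corner_ring R e) = carrier T"
proof -
  interpret H: ring_hom_ring R T h
    using assms(1-3) by (rule ring_hom_ringI2)
  note [simp] = ring_idempotentD(1)[OF e]
  have sub: "x \<in> peirce_component R e e \<Longrightarrow> x \<in> carrier R" for x
    by (auto simp: peirce_component_def)
  show "h \<in> ring_hom (corner_ring R e) T"
    by (rule ring_hom_memI) (use sub one in auto)
  have "h x = h (e \<otimes>\<^bsub>R\<^esub> x \<otimes>\<^bsub>R\<^esub> e)" if "x \<in> carrier R" for x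
    using that one by simp
  moreover have "e \<otimes>\<^bsub>R\<^esub> x \<otimes>\<^bsub>R\<^esub> e \<in> peirce_component R e e" if "x \<in> carrier R" for x
    using that by (auto simp: peirce_component_def)
  ultimately have "h ` carrier R \<subseteq> h ` peirce_component R e e"
    by (intro image_subsetI) (metis imageI)
  moreover have "h ` peirce_component R e e \<subseteq> h ` carrier R"
    using sub by (intro image_mono subsetI)
  ultimately show "h ` carrier (corner_ring R e) = carrier T"
    unfolding corner_ring_simps h(2)[symmetric] by (rule subset_antisym[rotated])
qed

section \<open>Gluing along a Peirce trivial idempotent\<close>

definition glue :: "nat \<Rightarrow> (nat \<Rightarrow> 'a) \<Rightarrow> (nat \<Rightarrow> 'a) \<Rightarrow> nat \<Rightarrow> 'a"
  where "glue m a b i = (if i \<le> m then a i else b (i - m))"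

lemma glue_cases:
  assumes "i \<in> {1..m + k}"
  obtains (left) "i \<in> {1..m}" "glue m a b i = a i"
  | (right) "i - m \<in> {1..k}" "i > m" "glue m a b i = b (i - m)"
proof (cases "i \<le> m")
  case True
  with assms left show thesis by (simp add: glue_def)
next
  case False
  with assms have "i - m \<in> {1..k}" by auto
  with False right show thesis by (simp add: glue_def)
qed

context ring
begin

lemma complete_orthogonal_glue:
  assumes e: "ring_idempotent R e"
    and a: "complete_orthogonal_idempotents (corner_ring R e) m a"
    and b: "complete_orthogonal_idempotents (corner_ring R (\<one> \<ominus> e)) k b"
  shows "complete_orthogonal_idempotents R (m + k) (glue m a b)"
proof -
  let ?f = "\<one> \<ominus> e"
  note f = idempotent_complement[OF e]
  interpret A: ring "corner_ring R e" by (rule ring_corner_ring[OF e])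
  interpret B: ring "corner_ring R ?f" by (rule ring_corner_ring[OF f(1)])
  note A = A.complete_orthogonalD[OF a, unfolded corner_ring_simps]
  note B = B.complete_orthogonalD[OF b, unfolded corner_ring_simps]
  have [simp]: "e \<in> carrier R" "?f \<in> carrier R" using e by (auto simp: ring_idempotent_def)
  have aR: "a i \<in> carrier R" "e \<otimes> a i = a i" "a i \<otimes> e = a i" if "i \<in> {1..m}" for i
    using A(2)[OF that] mem_peirce_component_iff[OF e e] by auto
  have bR: "b i \<in> carrier R" "?f \<otimes> b i = b i" "b i \<otimes> ?f = b i" if "i \<in> {1..k}" for i
    using B(2)[OF that] mem_peirce_component_iff[OF f(1) f(1)] by auto
  have ab: "a i \<otimes> b j = \<zero>" "b j \<otimes> a i = \<zero>" if i: "i \<in> {1..m}" and j: "j \<in> {1..k}" for i j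
  proof -
    have "a i \<otimes> b j = (a i \<otimes> e) \<otimes> (?f \<otimes> b j)" "b j \<otimes> a i = (b j \<otimes> ?f) \<otimes> (e \<otimes> a i)"
      using aR[OF i] bR[OF j] by simp_all
    moreover have "(a i \<otimes> e) \<otimes> (?f \<otimes> b j) = a i \<otimes> (e \<otimes> ?f) \<otimes> b j"
      "(b j \<otimes> ?f) \<otimes> (e \<otimes> a i) = b j \<otimes> (?f \<otimes> e) \<otimes> a i"
      using aR(1)[OF i] bR(1)[OF j] by (simp_all add: m_assoc)
    ultimately show "a i \<otimes> b j = \<zero>" "b j \<otimes> a i = \<zero>"
      using aR(1)[OF i] bR(1)[OF j] f by simp_all
  qed
  have idem: "ring_idempotent R (glue m a b i)" if "i \<in> {1..m + k}" for i
    using that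
  proof (cases rule: glue_cases[where a = a and b = b])
    case left
    then show ?thesis using ring_idempotent_corner_ring(1)[OF e A(1)] by simp
  next
    case right
    then show ?thesis using ring_idempotent_corner_ring(1)[OF f(1) B(1)] by simp
  qed
  have orth: "glue m a b i \<otimes> glue m a b j = \<zero>"
    if i: "i \<in> {1..m + k}" and j: "j \<in> {1..m + k}" and "i \<noteq> j" for i j
    using i
  proof (cases rule: glue_cases[where a = a and b = b])
    case i: left
    from j show ?thesis
    proof (cases rule: glue_cases[where a = a and b = b])
      case left
      then show ?thesis using i A(4)[of i j] \<open>i \<noteq> j\<close> by simp
    next
      case right
      then show ?thesis using i ab by simp
    qed
  next
    case i: right
    from j show ?thesis
    proof (cases rule: glue_cases[where a = a and b = b])
      case left
      then show ?thesis using i ab by simp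
    next
      case right
      then show ?thesis using i B(4)[of "i - m" "j - m"] \<open>i \<noteq> j\<close> by simp
    qed
  qed
  have split: "{1..m + k} = {1..m} \<union> (\<lambda>i. i + m) ` {1..k}"
    using ivl_disj_un_two(8)[of 1 m "m + k"] by (auto simp: image_add_atLeastAtMost')
  have "(\<Oplus>i \<in> {1..m + k}. glue m a b i) = (\<Oplus>i \<in> {1..m} \<union> (\<lambda>i. i + m) ` {1..k}. glue m a b i)"
    by (simp only: split)
  also have "\<dots> = (\<Oplus>i \<in> {1..m}. glue m a b i) \<oplus> (\<Oplus>i \<in> (\<lambda>i. i + m) ` {1..k}. glue m a b i)"
    by (rule finsum_Un_disjoint) (use ring_idempotentD(1)[OF idem] in auto)
  also have "(\<Oplus>i \<in> {1..m}. glue m a b i) = (\<Oplus>i \<in> {1..m}. a i)"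
    by (rule finsum_cong') (use aR in \<open>auto simp: glue_def\<close>)
  also have "\<dots> = e"
    using A(5) finsum_corner_ring[OF e, of "{1..m}" a] A(2) by simp
  also have "(\<Oplus>i \<in> (\<lambda>i. i + m) ` {1..k}. glue m a b i) = (\<Oplus>i \<in> {1..k}. glue m a b (i + m))"
    by (rule finsum_reindex) (use ring_idempotentD(1)[OF idem] in auto)
  also have "\<dots> = (\<Oplus>i \<in> {1..k}. b i)"
    by (rule finsum_cong') (use bR in \<open>auto simp: glue_def\<close>)
  also have "\<dots> = ?f"
    using B(5) finsum_corner_ring[OF f(1), of "{1..k}" b] B(2) by simp
  also have "e \<oplus> ?f = \<one>"
    using a_lcomm[of e \<one> "\<ominus> e"] by (simp add: a_minus_def r_neg)
  finally show ?thesis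
    using idem orth by (auto simp: complete_orthogonal_idempotents_def)
qed

lemma peirce_trivial_product_zero:
  assumes e: "peirce_trivial R e"
    and "x \<in> peirce_component R e (\<one> \<ominus> e)" "y \<in> peirce_component R (\<one> \<ominus> e) e"
  shows "x \<otimes> y = \<zero>" "y \<otimes> x = \<zero>"
proof -
  let ?f = "\<one> \<ominus> e"
  have idem: "ring_idempotent R e"
    using e by (simp add: peirce_trivial_def inner_peirce_trivial_def)
  note f = idempotent_complement[OF idem]
  note [simp] = ring_idempotentD(1)[OF idem] ring_idempotentD(1)[OF f(1)]
  have x: "x \<in> carrier R" "e \<otimes> x = x" "x \<otimes> ?f = x" and y: "y \<in> carrier R" "?f \<otimes> y = y" "y \<otimes> e = y"
    using assms(2,3) mem_peirce_component_iff[OF idem f(1)] mem_peirce_component_iff[OF f(1) idem] by auto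
  have "e \<otimes> x \<otimes> ?f \<otimes> y \<otimes> e = \<zero>" "?f \<otimes> y \<otimes> e \<otimes> x \<otimes> ?f = \<zero>"
    using e x y by (auto simp: peirce_trivial_def inner_peirce_trivial_def outer_peirce_trivial_def)
  moreover have "e \<otimes> x \<otimes> ?f \<otimes> y \<otimes> e = x \<otimes> y"
    using x y by (simp add: m_assoc)
  moreover have "?f \<otimes> y \<otimes> e \<otimes> x \<otimes> ?f = y \<otimes> x"
    using x y by (simp add: m_assoc)
  ultimately show "x \<otimes> y = \<zero>" "y \<otimes> x = \<zero>" by simp_all
qed

lemma peirce_component_mono:
  assumes "ring_idempotent R e" "ring_idempotent R f"
    and "a \<in> peirce_component R e e" "b \<in> peirce_component R f f"
  shows "peirce_component R a b \<subseteq> peirce_component R e f"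
proof
  have [simp]: "a \<in> carrier R" "b \<in> carrier R" "e \<in> carrier R" "f \<in> carrier R"
    and ea: "e \<otimes> a = a" and bf: "b \<otimes> f = b"
    using assms by (auto simp: mem_peirce_component_iff ring_idempotent_def)
  fix z assume "z \<in> peirce_component R a b"
  then obtain x where x: "x \<in> carrier R" "z = a \<otimes> x \<otimes> b"
    by (auto simp: peirce_component_def)
  then have "e \<otimes> z = (e \<otimes> a) \<otimes> x \<otimes> b" "z \<otimes> f = a \<otimes> x \<otimes> (b \<otimes> f)"
    by (simp_all add: m_assoc)
  with x show "z \<in> peirce_component R e f"
    using assms by (simp add: mem_peirce_component_iff ea bf)
qed

text \<open>Two indices from the same group are handled inside the corner; for indices from different groups
  the entries lie in \<open>eR(1-e)\<close> and \<open>(1-e)Re\<close>.\<close>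

lemma peirce_orthogonal_glue:
  assumes e: "peirce_trivial R e"
    and a: "complete_orthogonal_idempotents (corner_ring R e) m a" "peirce_orthogonal (corner_ring R e) m a"
    and b: "complete_orthogonal_idempotents (corner_ring R (\<one> \<ominus> e)) k b"
      "peirce_orthogonal (corner_ring R (\<one> \<ominus> e)) k b"
  shows "peirce_orthogonal R (m + k) (glue m a b)"
proof -
  let ?f = "\<one> \<ominus> e" and ?c = "glue m a b"
  have idem: "ring_idempotent R e"
    using e by (simp add: peirce_trivial_def inner_peirce_trivial_def)
  note f = idempotent_complement[OF idem]
  have a_in: "a i \<in> peirce_component R e e" if "i \<in> {1..m}" for i
    using a(1) that by (auto simp: complete_orthogonal_idempotents_def ring_idempotent_def)
  have b_in: "b i \<in> peirce_component R ?f ?f" if "i \<in> {1..k}" for i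
    using b(1) that by (auto simp: complete_orthogonal_idempotents_def ring_idempotent_def)
  have "x \<otimes> y = \<zero>"
    if i: "i \<in> {1..m + k}" and j: "j \<in> {1..m + k}" and "i \<noteq> j"
      and x: "x \<in> peirce_component R (?c i) (?c j)" and y: "y \<in> peirce_component R (?c j) (?c i)" for i j x y
    using i
  proof (cases rule: glue_cases[where a = a and b = b])
    case i: left
    from j show ?thesis
    proof (cases rule: glue_cases[where a = a and b = b])
      case j: left
      have "x \<in> peirce_component (corner_ring R e) (a i) (a j)" "y \<in> peirce_component (corner_ring R e) (a j) (a i)"
        using x y i j a_in by (simp_all add: peirce_component_corner_ring[OF idem])
      then show ?thesis
        using a(2) i(1) j(1) \<open>i \<noteq> j\<close> unfolding peirce_orthogonal_def corner_ring_simps by blast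
    next
      case j: right
      have "x \<in> peirce_component R e ?f" "y \<in> peirce_component R ?f e"
        using x y i j peirce_component_mono[OF idem f(1) a_in[OF i(1)] b_in[OF j(1)]]
          peirce_component_mono[OF f(1) idem b_in[OF j(1)] a_in[OF i(1)]] by auto
      then show ?thesis by (rule peirce_trivial_product_zero(1)[OF e])
    qed
  next
    case i: right
    from j show ?thesis
    proof (cases rule: glue_cases[where a = a and b = b])
      case j: left
      have "y \<in> peirce_component R e ?f" "x \<in> peirce_component R ?f e"
        using x y i j peirce_component_mono[OF idem f(1) a_in[OF j(1)] b_in[OF i(1)]]
          peirce_component_mono[OF f(1) idem b_in[OF i(1)] a_in[OF j(1)]] by auto
      then show ?thesis by (rule peirce_trivial_product_zero(2)[OF e])
    next
      case j: right
      have "i - m \<noteq> j - m" using i j \<open>i \<noteq> j\<close> by linarith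
      moreover have "x \<in> peirce_component (corner_ring R ?f) (b (i - m)) (b (j - m))"
        "y \<in> peirce_component (corner_ring R ?f) (b (j - m)) (b (i - m))"
        using x y i j b_in by (simp_all add: peirce_component_corner_ring[OF f(1)])
      ultimately show ?thesis
        using b(2) i(1) j(1) unfolding peirce_orthogonal_def corner_ring_simps by blast
    qed
  qed
  then show ?thesis unfolding peirce_orthogonal_def by blast
qed

end

section \<open>The recursive decomposition\<close>

text \<open>The property of the recursively constructed idempotents that an arbitrary representation may
  lack, and on which uniqueness depends. The target \<open>T\<close> has the type of \<open>R\<close>, which suffices as
  the targets of interest are corners of \<open>R\<close>.\<close>

definition concentrates_in_one_peirce_images :: "('a, 'm) ring_scheme \<Rightarrow> nat \<Rightarrow> (nat \<Rightarrow> 'a) \<Rightarrow> bool"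
  where "concentrates_in_one_peirce_images R n e \<longleftrightarrow>
    (\<forall>(T :: ('a, 'm) ring_scheme) h. peirce_ring 1 T \<and> h \<in> ring_hom R T \<and> h ` carrier R = carrier T \<longrightarrow>
      (\<exists>i \<in> {1..n}. h (e i) = \<one>\<^bsub>T\<^esub>))"

text \<open>The last conjunct is the point of the strengthened induction. For \<open>n = 0\<close> the zero ring has no
  homomorphism to a ring with \<open>1 \<noteq> 0\<close>; in the recursive step either \<open>e\<close> or \<open>1 - e\<close> is sent to 1,
  and the homomorphism remains surjective on the corresponding corner.\<close>

lemma peirce_ring_decomposition:
  fixes R :: "('a, 'm) ring_scheme"
  assumes "peirce_ring n R"
  shows "\<exists>e. complete_orthogonal_idempotents R n e \<and> peirce_orthogonal R n e \<and>
    (\<forall>i \<in> {1..n}. peirce_ring 1 (corner_ring R (e i))) \<and> concentrates_in_one_peirce_images R n e"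
  using assms
proof (induction rule: peirce_ring.induct)
  case (peirce_ring_0 R)
  interpret ring R by fact
  have "\<not> (peirce_ring 1 T \<and> h \<in> ring_hom R T)" for T :: "('a, 'm) ring_scheme" and h
  proof
    assume T: "peirce_ring 1 T \<and> h \<in> ring_hom R T"
    then interpret H: ring_hom_ring R T h
      using peirce_ring_oneD(1) ring_axioms by (blast intro: ring_hom_ringI2)
    have "\<one>\<^bsub>T\<^esub> = \<zero>\<^bsub>T\<^esub>"
      using arg_cong[OF \<open>\<one>\<^bsub>R\<^esub> = \<zero>\<^bsub>R\<^esub>\<close>, of h] by simp
    with T show False using peirce_ring_oneD(2) by blast
  qed
  then show ?case
    using \<open>\<one>\<^bsub>R\<^esub> = \<zero>\<^bsub>R\<^esub>\<close>
    by (intro exI[of _ "\<lambda>_. \<one>\<^bsub>R\<^esub>"])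
      (auto simp: complete_orthogonal_idempotents_def peirce_orthogonal_def concentrates_in_one_peirce_images_def)
next
  case (peirce_ring_1 R)
  interpret ring R by fact
  have "peirce_ring 1 R" using peirce_ring_1 by (rule peirce_ring.peirce_ring_1)
  then show ?case
    by (intro exI[of _ "\<lambda>_. \<one>\<^bsub>R\<^esub>"])
      (auto simp: complete_orthogonal_idempotents_def peirce_orthogonal_def concentrates_in_one_peirce_images_def
        ring_idempotent_def corner_ring_one ring_hom_one)
next
  case (peirce_ring_step R n e m)
  interpret ring R by fact
  let ?f = "\<one>\<^bsub>R\<^esub> \<ominus>\<^bsub>R\<^esub> e"
  have idem: "ring_idempotent R e"
    using \<open>peirce_trivial R e\<close> by (simp add: peirce_trivial_def inner_peirce_trivial_def)
  note f = idempotent_complement[OF idem]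
  from peirce_ring_step.IH(1) obtain a where a: "complete_orthogonal_idempotents (corner_ring R e) m a"
    "peirce_orthogonal (corner_ring R e) m a"
    "\<And>i. i \<in> {1..m} \<Longrightarrow> peirce_ring 1 (corner_ring (corner_ring R e) (a i))"
    "concentrates_in_one_peirce_images (corner_ring R e) m a" by blast
  from peirce_ring_step.IH(2) obtain b where b: "complete_orthogonal_idempotents (corner_ring R ?f) (n - m) b"
    "peirce_orthogonal (corner_ring R ?f) (n - m) b"
    "\<And>i. i \<in> {1..n - m} \<Longrightarrow> peirce_ring 1 (corner_ring (corner_ring R ?f) (b i))"
    "concentrates_in_one_peirce_images (corner_ring R ?f) (n - m) b" by blast
  let ?c = "glue m a b"
  have n: "m + (n - m) = n" using \<open>m < n\<close> by simp
  have "peirce_ring 1 (corner_ring R (?c i))" if "i \<in> {1..m + (n - m)}" for i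
    using that
  proof (cases rule: glue_cases[where a = a and b = b])
    case left
    then have "a i \<in> peirce_component R e e"
      using a(1) by (auto simp: complete_orthogonal_idempotents_def ring_idempotent_def)
    then show ?thesis
      using left a(3)[OF left(1)] by (simp add: corner_ring_corner_ring[OF idem])
  next
    case right
    then have "b (i - m) \<in> peirce_component R ?f ?f"
      using b(1) by (auto simp: complete_orthogonal_idempotents_def ring_idempotent_def)
    then show ?thesis
      using right b(3)[OF right(1)] by (simp add: corner_ring_corner_ring[OF f(1)])
  qed
  moreover have "\<exists>i \<in> {1..n}. h (?c i) = \<one>\<^bsub>T\<^esub>"
    if T: "peirce_ring 1 T" and h: "h \<in> ring_hom R T" "h ` carrier R = carrier T"
    for T :: "('a, 'm) ring_scheme" and h
  proof -
    interpret T: ring T using peirce_ring_oneD(1)[OF T] .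
    note he = peirce_trivial_hom_image[OF ring_axioms T.ring_axioms h \<open>peirce_trivial R e\<close>]
    from peirce_ring_oneD(3)[OF T he(1)] consider "h e = \<one>\<^bsub>T\<^esub>" | "h ?f = \<one>\<^bsub>T\<^esub>"
      unfolding he(2) by (auto simp: a_minus_def)
    then show ?thesis
    proof cases
      case 1
      then obtain i where "i \<in> {1..m}" "h (a i) = \<one>\<^bsub>T\<^esub>"
        using a(4) T hom_restrict_corner[OF ring_axioms T.ring_axioms h idem]
        unfolding concentrates_in_one_peirce_images_def by blast
      then show ?thesis using \<open>m < n\<close> by (intro bexI[of _ i]) (auto simp: glue_def)
    next
      case 2
      then obtain i where "i \<in> {1..n - m}" "h (b i) = \<one>\<^bsub>T\<^esub>"
        using b(4) T hom_restrict_corner[OF ring_axioms T.ring_axioms h f(1)]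
        unfolding concentrates_in_one_peirce_images_def by blast
      then show ?thesis by (intro bexI[of _ "i + m"]) (auto simp: glue_def)
    qed
  qed
  ultimately show ?case
    using complete_orthogonal_glue[OF idem a(1) b(1)]
      peirce_orthogonal_glue[OF \<open>peirce_trivial R e\<close> a(1,2) b(1,2)]
    unfolding n concentrates_in_one_peirce_images_def by blast
qed

text \<open>The matrix part of a representation is automatic.\<close>

lemma (in ring) peirce_representation_iff:
  "peirce_representation R n e \<longleftrightarrow>
    complete_orthogonal_idempotents R n e \<and> peirce_orthogonal R n e \<and>
    (\<forall>i \<in> {1..n}. peirce_ring 1 (corner_ring R (e i)))"
  using matrix_iso ring_generalized_matrix_ring
  unfolding peirce_representation_def peirce_orthogonal_def is_ring_iso_def by blast

lemma (in ring) corner_rings_iso_to_concentrating: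
  assumes e: "peirce_representation R n e" "concentrates_in_one_peirce_images R n e"
    and f: "peirce_representation R n f"
  shows "\<exists>\<sigma>. bij_betw \<sigma> {1..n} {1..n} \<and> (\<forall>i \<in> {1..n}. corner_ring R (e i) \<simeq> corner_ring R (f (\<sigma> i)))"
proof -
  have e': "complete_orthogonal_idempotents R n e" "peirce_orthogonal R n e"
    "\<And>i. i \<in> {1..n} \<Longrightarrow> peirce_ring 1 (corner_ring R (e i))"
    and f': "complete_orthogonal_idempotents R n f" "peirce_orthogonal R n f"
    "\<And>i. i \<in> {1..n} \<Longrightarrow> peirce_ring 1 (corner_ring R (f i))"
    using e(1) f by (simp_all add: peirce_representation_iff)
  show ?thesis
  proof (rule corner_rings_iso_up_to_permutation[OF e'(1,2) f'(1,2)])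
    show "e i \<noteq> \<zero>" if "i \<in> {1..n}" for i
      using peirce_ring_oneD(2)[OF e'(3)[OF that]] by simp
    show "\<exists>i \<in> {1..n}. f j \<otimes> e i \<otimes> f j = f j" if "j \<in> {1..n}" for j
      using e(2) f'(3)[OF that] compression_hom[OF f'(1,2) that]
      unfolding concentrates_in_one_peirce_images_def by fastforce
  qed
qed

theorem proposition4p7:
  fixes R :: "('a, 'm) ring_scheme" and n :: nat
  assumes "peirce_ring n R"
  shows "(\<exists>e. peirce_representation R n e) \<and>
    (\<forall>e f. peirce_representation R n e \<and> peirce_representation R n f \<longrightarrow>
      (\<exists>\<sigma>. bij_betw \<sigma> {1..n} {1..n} \<and>
        (\<forall>i \<in> {1..n}. corner_ring R (e i) \<simeq> corner_ring R (f (\<sigma> i))))) \<and>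
    (\<forall>e (P :: ('a, 'm) ring_scheme \<Rightarrow> bool).
      peirce_representation R n e \<and>
      (transfers_to_hom_images P \<or> transfers_to_corners P) \<and> P R \<longrightarrow>
      (\<forall>i \<in> {1..n}. P (corner_ring R (e i))))"
proof (intro conjI allI impI ballI)
  interpret ring R using peirce_ring_imp_ring[OF assms] .
  from peirce_ring_decomposition[OF assms] obtain d
    where d: "peirce_representation R n d" "concentrates_in_one_peirce_images R n d"
    by (auto simp: peirce_representation_iff)
  then show "\<exists>e. peirce_representation R n e" by blast
  {
    fix e f assume ef: "peirce_representation R n e \<and> peirce_representation R n f"
    obtain \<sigma> where \<sigma>: "bij_betw \<sigma> {1..n} {1..n}"
      "\<And>i. i \<in> {1..n} \<Longrightarrow> corner_ring R (d i) \<simeq> corner_ring R (e (\<sigma> i))"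
      using corner_rings_iso_to_concentrating[OF d] ef by blast
    obtain \<tau> where \<tau>: "bij_betw \<tau> {1..n} {1..n}"
      "\<And>i. i \<in> {1..n} \<Longrightarrow> corner_ring R (d i) \<simeq> corner_ring R (f (\<tau> i))"
      using corner_rings_iso_to_concentrating[OF d] ef by blast
    let ?\<rho> = "inv_into {1..n} \<sigma>"
    have "corner_ring R (e i) \<simeq> corner_ring R (f ((\<tau> \<circ> ?\<rho>) i))" if i: "i \<in> {1..n}" for i
    proof -
      have k: "?\<rho> i \<in> {1..n}" "\<sigma> (?\<rho> i) = i"
        using \<sigma>(1) i by (metis bij_betw_def inv_into_into, metis bij_betw_def f_inv_into_f)
      have "ring (corner_ring R (d (?\<rho> i)))"
        using d(1) k(1) by (simp add: peirce_representation_iff peirce_ring_oneD(1))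
      then have "corner_ring R (e i) \<simeq> corner_ring R (d (?\<rho> i))"
        using ring_iso_sym \<sigma>(2)[OF k(1)] k(2) by fastforce
      then show ?thesis using ring_iso_trans \<tau>(2)[OF k(1)] by fastforce
    qed
    with bij_betw_trans[OF bij_betw_inv_into[OF \<sigma>(1)] \<tau>(1)]
    show "\<exists>\<sigma>. bij_betw \<sigma> {1..n} {1..n} \<and> (\<forall>i \<in> {1..n}. corner_ring R (e i) \<simeq> corner_ring R (f (\<sigma> i)))"
      by blast
  next
    fix e i and P :: "('a, 'm) ring_scheme \<Rightarrow> bool"
    assume P: "peirce_representation R n e \<and> (transfers_to_hom_images P \<or> transfers_to_corners P) \<and> P R"
      and i: "i \<in> {1..n}"
    then have e: "complete_orthogonal_idempotents R n e" "peirce_orthogonal R n e"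
      by (simp_all add: peirce_representation_iff)
    have idem: "ring_idempotent R (e i)" using complete_orthogonalD(1)[OF e(1) i] .
    show "P (corner_ring R (e i))"
      using P compression_hom[OF e i] idem ring_axioms ring_corner_ring[OF idem]
      unfolding transfers_to_hom_images_def transfers_to_corners_def by blast
  }
qed

end
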